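(* When $\lambda\to\infty$, the transition kernel $p^{(\lambda)}((b,h),(b',h'))$ converges pointwise in $(0,\infty)^2$ to $p^{(\infty)}((b,h),(b',h'))$, where $$p^{(\infty)}((b,h),(b',h'))=\frac{4(b-b')b'}{h'^2}\exp\Big(-\frac23b^3\Big(\frac1{h'}-\frac1h\Big)\Big)\mathbf 1_{(0,b)\times(0,h)}(b',h').$$ Moreover, a representation of the Markov chain with transition kernel $p^{(\infty)}$ is given by the sequence $\{(B_n^{(\infty)},H_n^{(\infty)})\}_n$ defined by the almost sure induction equality $$(B_{n+1}^{(\infty)},H_{n+1}^{(\infty)})=\Bigg(\beta_nB_n^{(\infty)},\frac{(B_n^{(\infty)})^3H_n^{(\infty)}}{(B_n^{(\infty)})^3+\frac32\xi_nH_n^{(\infty)}}\Bigg),$$ where $\{\beta_n\}_n$ and $\{\xi_n\}_n$ are two independent sequences of independent and identically distributed random variables such that $\beta_n\sim\mathrm{Beta}(2,2)$ and $\xi_n\sim\mathrm{Exp}(1)$ respectively.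
   Context: For $\lambda>0$ and $(b,h),(b',h')\in(0,\infty)^2$, $$p^{(\lambda)}((b,h),(b',h'))=\frac{4b'}{h'^2+\lambda^{-4/3}b'^2}\Big(b\Big(1-\lambda^{-4/3}\frac{b^2-b'^2}{h'^2}\Big)^{-1/2}-b'\Big)e^{-A^{(\lambda)}(b,h,b',h')}\,\mathbf 1_{S_{(b,h)}}(b',h'),$$ where $$S_{(b,h)}=\Big\{(b',h'):0<b'<b\ \text{ and }\ \lambda^{-2/3}(b^2-b'^2)^{1/2}<h'<(h^2+\lambda^{-4/3}(b^2-b'^2))^{1/2}\Big\}$$ and $$A^{(\lambda)}(b,h,b',h')=(\lambda^2h'^2+\lambda^{2/3}b'^2)\Big(\arctan\Big(\frac{\lambda^{1/3}b}{(\lambda^2h'^2-\lambda^{2/3}(b^2-b'^2))^{1/2}}\Big)-\frac{\lambda^{1/3}b\,(\lambda^2h'^2-\lambda^{2/3}(b^2-b'^2))^{1/2}}{\lambda^2h'^2+\lambda^{2/3}b'^2}\Big)$$ $$-(\lambda^2h^2+\lambda^{2/3}b^2)\Big(\arctan\big(\lambda^{-2/3}\tfrac bh\big)-\lambda^{-2/3}\tfrac bh\big(1+\lambda^{-4/3}\tfrac{b^2}{h^2}\big)^{-1}\Big).$$ ($p^{(\lambda)}$ is the transition kernel, written as a density in $(b',h')$, of the Markov chain of normalized half-bases and heights of the isosceles triangles describing the left branch of the boundary of a typical Poisson–Voronoi cell with highest vertex at height $\lambda$, for a Poisson point process in the lower half-plane.)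
   Formalization: Pointwise convergence is claimed except at points with h' = h and b' < b, where it fails: p^(λ) tends to 4(b-b')b'/h² > 0 but the printed indicator makes p^(∞) zero there. *)

theory Defs
  imports "HOL-Probability.Probability"
begin

section \<open>The transition densities\<close>

text \<open>A state \<open>(b, h)\<close> is a normalized half-base and height of an isosceles triangle.\<close>

definition states :: "(real \<times> real) set" where
  "states = {0<..} \<times> {0<..}"

definition S_region :: "real \<Rightarrow> real \<times> real \<Rightarrow> (real \<times> real) set" where
  "S_region lam = (\<lambda>(b, h). {(b', h').
     0 < b' \<and> b' < b \<and>
     lam powr (-2/3) * sqrt (b\<^sup>2 - b'\<^sup>2) < h' \<and>
     h' < sqrt (h\<^sup>2 + lam powr (-4/3) * (b\<^sup>2 - b'\<^sup>2))})"

definition A_exponent :: "real \<Rightarrow> real \<times> real \<Rightarrow> real \<times> real \<Rightarrow> real" where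
  "A_exponent lam = (\<lambda>(b, h) (b', h').
     (lam\<^sup>2 * h'\<^sup>2 + lam powr (2/3) * b'\<^sup>2) *
       (arctan (lam powr (1/3) * b / sqrt (lam\<^sup>2 * h'\<^sup>2 - lam powr (2/3) * (b\<^sup>2 - b'\<^sup>2)))
        - lam powr (1/3) * b * sqrt (lam\<^sup>2 * h'\<^sup>2 - lam powr (2/3) * (b\<^sup>2 - b'\<^sup>2))
            / (lam\<^sup>2 * h'\<^sup>2 + lam powr (2/3) * b'\<^sup>2))
     - (lam\<^sup>2 * h\<^sup>2 + lam powr (2/3) * b\<^sup>2) *
       (arctan (lam powr (-2/3) * (b / h))
        - lam powr (-2/3) * (b / h) * inverse (1 + lam powr (-4/3) * (b\<^sup>2 / h\<^sup>2))))"

definition p_lam :: "real \<Rightarrow> real \<times> real \<Rightarrow> real \<times> real \<Rightarrow> real" where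
  "p_lam lam = (\<lambda>(b, h) (b', h').
     4 * b' / (h'\<^sup>2 + lam powr (-4/3) * b'\<^sup>2) *
     (b * (1 - lam powr (-4/3) * ((b\<^sup>2 - b'\<^sup>2) / h'\<^sup>2)) powr (-1/2) - b') *
     exp (- A_exponent lam (b, h) (b', h')) *
     indicator (S_region lam (b, h)) (b', h'))"

definition p_inf :: "real \<times> real \<Rightarrow> real \<times> real \<Rightarrow> real" where
  "p_inf = (\<lambda>(b, h) (b', h').
     4 * (b - b') * b' / h'\<^sup>2 *
     exp (- (2/3) * b ^ 3 * (1 / h' - 1 / h)) *
     indicator ({0<..<b} \<times> {0<..<h}) (b', h'))"

text \<open>For \<open>h' = h\<close> and \<open>0 < b' < b\<close> the point \<open>(b', h')\<close> lies in \<^term>\<open>S_region lam (b, h)\<close>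
  for all large \<^term>\<open>lam\<close>, and \<^term>\<open>p_lam\<close> tends to \<open>4 * (b - b') * b' / h\<^sup>2 > 0\<close> there, while
  \<^term>\<open>p_inf\<close> vanishes because its indicator is that of an open rectangle.  On this Lebesgue-null
  set, and only there, the pointwise convergence fails.\<close>

section \<open>Markov chains\<close>

definition transition_kernel_on :: "'s::topological_space set \<Rightarrow> ('s \<Rightarrow> 's measure) \<Rightarrow> bool" where
  "transition_kernel_on E K \<longleftrightarrow>
     K \<in> restrict_space borel E \<rightarrow>\<^sub>M prob_algebra borel \<and> (\<forall>x\<in>E. AE y in K x. y \<in> E)"

definition density_kernel :: "('s::euclidean_space \<Rightarrow> 's \<Rightarrow> real) \<Rightarrow> 's \<Rightarrow> 's measure" where
  "density_kernel p x = density lborel (\<lambda>y. ennreal (p x y))"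

definition natural_filtration ::
  "'w measure \<Rightarrow> (nat \<Rightarrow> 'w \<Rightarrow> 's::topological_space) \<Rightarrow> nat \<Rightarrow> 'w measure" where
  "natural_filtration M X n =
     sigma (space M) (\<Union>i\<le>n. {X i -` A \<inter> space M |A. A \<in> sets borel})"

text \<open>The state space \<^term>\<open>E\<close> is only charged almost surely, so that sequences defined by almost
  sure identities are allowed; the values of \<^term>\<open>K\<close> outside \<^term>\<open>E\<close> are irrelevant.\<close>

definition markov_chain_with_kernel ::
  "'w measure \<Rightarrow> 's::topological_space set \<Rightarrow> ('s \<Rightarrow> 's measure) \<Rightarrow> (nat \<Rightarrow> 'w \<Rightarrow> 's) \<Rightarrow> bool" where
  "markov_chain_with_kernel M E K X \<longleftrightarrow>
     transition_kernel_on E K \<and>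
     (\<forall>n. X n \<in> borel_measurable M) \<and>
     (\<forall>n. AE \<omega> in M. X n \<omega> \<in> E) \<and>
     (\<forall>n. \<forall>A\<in>sets borel. AE \<omega> in M.
        real_cond_exp M (natural_filtration M X n) (\<lambda>\<omega>. indicator A (X (Suc n) \<omega>)) \<omega>
          = measure (K (X n \<omega>)) A)"

section \<open>The driving random variables\<close>

definition beta_density :: "real \<Rightarrow> real \<Rightarrow> real \<Rightarrow> real" where
  "beta_density a b x =
     indicator {0<..<1} x * x powr (a - 1) * (1 - x) powr (b - 1) / Beta a b"

text \<open>The two sequences are independent of each other as random elements of the product space of
  real sequences, and jointly independent of the initial state \<^term>\<open>X0\<close>.\<close>

definition driving_sequences ::
  "'w measure \<Rightarrow> ('w \<Rightarrow> real \<times> real) \<Rightarrow> (nat \<Rightarrow> 'w \<Rightarrow> real) \<Rightarrow> (nat \<Rightarrow> 'w \<Rightarrow> real) \<Rightarrow> bool" where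
  "driving_sequences M X0 \<beta> \<xi> \<longleftrightarrow>
     (\<forall>n. distributed M lborel (\<beta> n) (\<lambda>x. ennreal (beta_density 2 2 x))) \<and>
     (\<forall>n. distributed M lborel (\<xi> n) (\<lambda>x. ennreal (exponential_density 1 x))) \<and>
     prob_space.indep_vars M (\<lambda>_. borel) \<beta> UNIV \<and>
     prob_space.indep_vars M (\<lambda>_. borel) \<xi> UNIV \<and>
     prob_space.indep_var M
       (\<Pi>\<^sub>M n\<in>UNIV. borel) (\<lambda>\<omega> n. \<beta> n \<omega>) (\<Pi>\<^sub>M n\<in>UNIV. borel) (\<lambda>\<omega> n. \<xi> n \<omega>) \<and>
     prob_space.indep_set M
       {X0 -` A \<inter> space M |A. A \<in> sets borel}
       {(\<lambda>\<omega>. (\<lambda>n. \<beta> n \<omega>, \<lambda>n. \<xi> n \<omega>)) -` C \<inter> space M |C.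
          C \<in> sets ((\<Pi>\<^sub>M n\<in>UNIV. borel) \<Otimes>\<^sub>M (\<Pi>\<^sub>M n\<in>UNIV. borel))}"

end

theory Submission
  imports Defs "HOL-Real_Asymp.Real_Asymp"
begin

text \<open>
  Limit of the densities. Put \<open>k = lam powr (1/3)\<close>. The exponent \<open>A_exponent\<close> is a difference of two
  terms \<open>R\<^sup>2 (arctan u - u / (1 + u\<^sup>2))\<close>, where \<open>u\<close> is the slope of a thin right triangle with long leg
  \<open>k ^ 3 * c\<close>, short leg \<open>k * b\<close> and hypotenuse \<open>R\<close>. For the current triangle \<open>c = h\<close>; for the next
  one \<open>c\<close> is the root \<open>s\<close> with \<open>s\<^sup>2 = h'\<^sup>2 - (b\<^sup>2 - b'\<^sup>2) / k ^ 4\<close>, chosen so that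
  \<open>s\<^sup>2 + b\<^sup>2 / k ^ 4 = h'\<^sup>2 + b'\<^sup>2 / k ^ 4\<close>. Both terms have the same short leg, so both have the
  form \<open>b ^ 3 / c\<close> times one function of \<open>u\<close>, which tends to \<open>2/3\<close> as \<open>u\<close> tends to \<open>0\<close>
  (\<open>A_exponent_eq_arctan_remainder\<close>). The other factors converge by continuity, and off the line
  \<open>h' = h\<close> the indicator is eventually constant.

  Law of one step. Given \<open>(b, h)\<close>, the next half-base depends on the Beta variable alone and the next
  height on the exponential variable alone. The joint density is therefore a product of two
  one-dimensional densities, each given by a change of variables (\<open>distributed_transform\<close>):
  \<open>6 b' (b - b') / b ^ 3\<close> for the half-base and \<open>2/3 b ^ 3 / h'\<^sup>2 exp (- 2/3 b ^ 3 (1/h' - 1/h))\<close>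
  for the height, since \<open>1/h' = 1/h + 3/2 \<xi> / b ^ 3\<close>. Their product is \<open>p_inf\<close>.

  Markov property. If \<open>X (n+1) = f (X n, W n)\<close> almost surely and \<open>W n\<close> is independent of the past of
  \<open>X\<close>, then Fubini's theorem for the joint law of the past and \<open>W n\<close> gives the conditional law of
  \<open>X (n+1)\<close>: it is the law of \<open>f (x, W n)\<close> at \<open>x = X n\<close> (\<open>markov_chain_random_recursion\<close>).
  It remains to see that \<open>(\<beta> n, \<xi> n)\<close> is independent of the past of the chain. The three
  independence hypotheses together say that the initial state and all the \<open>\<beta> i\<close> and \<open>\<xi> j\<close> form one
  independent family (\<open>indep_sets_source_events\<close>), so the pair is independent of the \<open>\<sigma>\<close>-algebra of
  the initial state and the earlier variables. The recursion holds only almost surely, so the chain is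
  adapted to that \<open>\<sigma>\<close>-algebra only up to null sets; enlarging it by null sets preserves independence.
\<close>

section \<open>Limit of the transition densities\<close>

text \<open>The function \<open>(1 + u\<^sup>2) (arctan u - u / (1 + u\<^sup>2))\<close>, which vanishes to third order at \<open>0\<close>,
  scaled to have a finite nonzero limit.\<close>

definition arctan_remainder :: "real \<Rightarrow> real" where
  "arctan_remainder u = ((1 + u\<^sup>2) * arctan u - u) / u ^ 3"

lemma arctan_remainder_tendsto: "(arctan_remainder \<longlongrightarrow> 2 / 3) (at_right 0)"
  unfolding arctan_remainder_def by real_asymp

text \<open>With \<open>k = lam powr (1/3)\<close> all fractional powers of \<open>lam\<close> become integer powers of \<open>k\<close>. The point of
  the root \<open>s\<close> is the identity \<open>(k ^ 3 h')\<^sup>2 + (k b')\<^sup>2 = (k ^ 3 s)\<^sup>2 + (k b)\<^sup>2\<close>: it expresses the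
  \<open>(b', h')\<close>-half of the exponent by the same formula as the \<open>(b, h)\<close>-half, with \<open>s\<close> in place of \<open>h\<close>.\<close>

lemma A_exponent_eq_arctan_remainder:
  fixes b h b' h' k :: real
  defines "s \<equiv> sqrt (h'\<^sup>2 - (b\<^sup>2 - b'\<^sup>2) / k ^ 4)"
  assumes pos: "0 < k" "0 < b" "0 < h" and s: "0 < h'\<^sup>2 - (b\<^sup>2 - b'\<^sup>2) / k ^ 4"
  shows "A_exponent (k ^ 3) (b, h) (b', h') =
    b ^ 3 * (arctan_remainder (b / (k\<^sup>2 * s)) / s - arctan_remainder (b / (k\<^sup>2 * h)) / h)"
proof -
  have powr: "(k ^ 3) powr (1/3) = k" "(k ^ 3) powr (2/3) = k\<^sup>2"
      "(k ^ 3) powr (-2/3) = 1 / k\<^sup>2" "(k ^ 3) powr (-4/3) = 1 / k ^ 4"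
    using pos by (simp_all add: powr_powr powr_minus_divide flip: powr_numeral)
  have s_pos: "0 < s" and s_sq: "s\<^sup>2 = h'\<^sup>2 - (b\<^sup>2 - b'\<^sup>2) / k ^ 4"
    using s by (simp_all add: s_def)
  \<comment> \<open>The common formula of both halves, with long leg \<open>k ^ 3 * c\<close> and short leg \<open>k * b\<close>.\<close>
  have half_exponent: "(c\<^sup>2 * k ^ 6 + k\<^sup>2 * b\<^sup>2) * (arctan (b / (k\<^sup>2 * c)) -
      k * b * (k ^ 3 * c) / (c\<^sup>2 * k ^ 6 + k\<^sup>2 * b\<^sup>2)) = b ^ 3 * (arctan_remainder (b / (k\<^sup>2 * c)) / c)"
    if "0 < c" for c
  proof -
    have ne: "c\<^sup>2 * k ^ 6 + k\<^sup>2 * b\<^sup>2 \<noteq> 0" using pos that by (smt (verit) mult_pos_pos zero_less_power)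
    have "(c\<^sup>2 * k ^ 6 + k\<^sup>2 * b\<^sup>2) * (arctan (b / (k\<^sup>2 * c)) -
      k * b * (k ^ 3 * c) / (c\<^sup>2 * k ^ 6 + k\<^sup>2 * b\<^sup>2))
      = (c\<^sup>2 * k ^ 6 + k\<^sup>2 * b\<^sup>2) * arctan (b / (k\<^sup>2 * c)) - k * b * (k ^ 3 * c)"
      using ne by (simp add: right_diff_distrib)
    also have "\<dots> = b ^ 3 * (arctan_remainder (b / (k\<^sup>2 * c)) / c)"
      unfolding arctan_remainder_def using pos that
      by (simp add: divide_simps) (simp add: algebra_simps eval_nat_numeral)
    finally show ?thesis .
  qed
  have rad: "(k ^ 3)\<^sup>2 * h'\<^sup>2 - k\<^sup>2 * (b\<^sup>2 - b'\<^sup>2) = (k ^ 3 * s)\<^sup>2"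
    unfolding power_mult_distrib s_sq using pos by (simp add: field_simps eval_nat_numeral)
  have root: "sqrt ((k ^ 3)\<^sup>2 * h'\<^sup>2 - k\<^sup>2 * (b\<^sup>2 - b'\<^sup>2)) = k ^ 3 * s"
    unfolding rad using pos s_pos by simp
  have sum: "(k ^ 3)\<^sup>2 * h'\<^sup>2 + k\<^sup>2 * b'\<^sup>2 = s\<^sup>2 * k ^ 6 + k\<^sup>2 * b\<^sup>2"
    unfolding s_sq using pos by (simp add: field_simps eval_nat_numeral)
  have arg: "k * b / (k ^ 3 * s) = b / (k\<^sup>2 * s)"
    using pos by (simp add: field_simps eval_nat_numeral)
  have first: "((k ^ 3)\<^sup>2 * h\<^sup>2 + k\<^sup>2 * b\<^sup>2) = h\<^sup>2 * k ^ 6 + k\<^sup>2 * b\<^sup>2"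
    by (simp add: flip: power_mult)
  have second: "1 / k\<^sup>2 * (b / h) * inverse (1 + 1 / k ^ 4 * (b\<^sup>2 / h\<^sup>2))
      = k * b * (k ^ 3 * h) / (h\<^sup>2 * k ^ 6 + k\<^sup>2 * b\<^sup>2)"
  proof -
    have "1 + 1 / k ^ 4 * (b\<^sup>2 / h\<^sup>2) = (h\<^sup>2 * k ^ 6 + k\<^sup>2 * b\<^sup>2) / (h\<^sup>2 * k ^ 6)"
      using pos by (simp add: field_simps eval_nat_numeral)
    then show ?thesis using pos by (simp add: eval_nat_numeral)
  qed
  have arg2: "1 / k\<^sup>2 * (b / h) = b / (k\<^sup>2 * h)" by simp
  show ?thesis
    unfolding A_exponent_def prod.case powr root sum arg first second
    unfolding arg2 half_exponent[OF s_pos] half_exponent[OF pos(3)] by (simp add: right_diff_distrib)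
qed

lemma A_exponent_tendsto:
  fixes b h b' h' :: real
  assumes pos: "0 < b" "0 < h" "0 < h'"
  shows "((\<lambda>k. A_exponent (k ^ 3) (b, h) (b', h')) \<longlongrightarrow> 2/3 * b ^ 3 * (1 / h' - 1 / h)) at_top"
proof -
  define s where "s = (\<lambda>k. sqrt (h'\<^sup>2 - (b\<^sup>2 - b'\<^sup>2) / k ^ 4))"
  have rad: "((\<lambda>k::real. h'\<^sup>2 - (b\<^sup>2 - b'\<^sup>2) / k ^ 4) \<longlongrightarrow> h'\<^sup>2) at_top"
    by real_asymp
  have s_lim: "(s \<longlongrightarrow> h') at_top"
    using tendsto_real_sqrt[OF rad] pos by (simp add: s_def)
  have remainder: "((\<lambda>k. arctan_remainder (b / (k\<^sup>2 * c k))) \<longlongrightarrow> 2 / 3) at_top"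
    if c: "(c \<longlongrightarrow> c0) at_top" and c0: "0 < c0" for c :: "real \<Rightarrow> real" and c0
  proof (rule filterlim_compose[OF arctan_remainder_tendsto])
    have "((\<lambda>k::real. b / k\<^sup>2) \<longlongrightarrow> 0) at_top" by real_asymp
    from tendsto_divide[OF this c] c0
    have "((\<lambda>k. b / (k\<^sup>2 * c k)) \<longlongrightarrow> 0) at_top" by simp
    moreover have "\<forall>\<^sub>F k in at_top. b / (k\<^sup>2 * c k) \<in> {0<..}"
      using order_tendstoD(1)[OF c c0] eventually_gt_at_top[of 0]
      by eventually_elim (use pos in simp)
    ultimately show "filterlim (\<lambda>k. b / (k\<^sup>2 * c k)) (at_right 0) at_top"
      by (auto simp: filterlim_at elim: eventually_mono)
  qed
  have "((\<lambda>k. b ^ 3 * (arctan_remainder (b / (k\<^sup>2 * s k)) / s k - arctan_remainder (b / (k\<^sup>2 * h)) / h))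
    \<longlongrightarrow> b ^ 3 * ((2 / 3) / h' - (2 / 3) / h)) at_top"
    using pos by (intro tendsto_intros remainder[OF s_lim] s_lim remainder[OF tendsto_const]) auto
  moreover have "\<forall>\<^sub>F k in at_top. A_exponent (k ^ 3) (b, h) (b', h') =
     b ^ 3 * (arctan_remainder (b / (k\<^sup>2 * s k)) / s k - arctan_remainder (b / (k\<^sup>2 * h)) / h)"
  proof -
    have "\<forall>\<^sub>F k in at_top. 0 < h'\<^sup>2 - (b\<^sup>2 - b'\<^sup>2) / k ^ 4"
      by (rule order_tendstoD(1)[OF rad]) (use pos in simp)
    then show ?thesis
      using eventually_gt_at_top[of 0]
      by eventually_elim (use pos in \<open>simp add: s_def A_exponent_eq_arctan_remainder\<close>)
  qed
  ultimately have "((\<lambda>k. A_exponent (k ^ 3) (b, h) (b', h'))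
      \<longlongrightarrow> b ^ 3 * ((2 / 3) / h' - (2 / 3) / h)) at_top"
    by (simp only: tendsto_cong)
  then show ?thesis
    by (simp add: algebra_simps diff_divide_distrib)
qed

text \<open>For \<open>b' < b\<close> the line \<open>h' = h\<close> is excluded because the upper boundary of \<^term>\<open>S_region\<close>
  decreases to \<open>h\<close> without reaching it, so that the limit of the indicators there is \<open>1\<close>.\<close>

lemma p_lam_tendsto_p_inf:
  fixes b h b' h' :: real
  assumes pos: "0 < b" "0 < h" "0 < b'" "0 < h'" and off: "h' \<noteq> h \<or> b \<le> b'"
  shows "((\<lambda>lam. p_lam lam (b, h) (b', h')) \<longlongrightarrow> p_inf (b, h) (b', h')) at_top"
proof -
  have vanish: "((\<lambda>lam. lam powr (-4/3) * c) \<longlongrightarrow> 0) at_top" 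
    "((\<lambda>lam. lam powr (-2/3) * c) \<longlongrightarrow> 0) at_top" for c :: real
    by real_asymp+
  have upper: "((\<lambda>lam. sqrt (h\<^sup>2 + lam powr (-4/3) * (b\<^sup>2 - b'\<^sup>2))) \<longlongrightarrow> h) at_top"
    using tendsto_real_sqrt[OF tendsto_add[OF tendsto_const vanish(1)], of "h\<^sup>2"] pos by simp
  consider "b \<le> b'" | "b' < b" "h < h'" | "b' < b" "h' < h" using off by linarith
  then show ?thesis
  proof cases
    case 1
    then show ?thesis by (simp add: p_lam_def p_inf_def S_region_def)
  next
    case 2
    have "\<forall>\<^sub>F lam in at_top. p_lam lam (b, h) (b', h') = p_inf (b, h) (b', h')"
      using order_tendstoD(2)[OF upper 2(2)]
      by eventually_elim (use 2 in \<open>simp add: p_lam_def p_inf_def S_region_def\<close>)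
    then show ?thesis by (rule tendsto_eventually)
  next
    case 3
    have cube_root: "filterlim (\<lambda>lam::real. lam powr (1/3)) at_top at_top" by real_asymp
    have A: "((\<lambda>lam. A_exponent ((lam powr (1/3)) ^ 3) (b, h) (b', h')) \<longlongrightarrow> 2/3 * b ^ 3 * (1 / h' - 1 / h)) at_top"
      by (rule filterlim_compose[OF A_exponent_tendsto cube_root]) (use pos in auto)
    have A: "((\<lambda>lam. A_exponent lam (b, h) (b', h')) \<longlongrightarrow> 2/3 * b ^ 3 * (1 / h' - 1 / h)) at_top"
      by (rule Lim_transform_eventually[OF A])
         (use eventually_gt_at_top[of 0] in \<open>eventually_elim, simp add: powr_powr flip: powr_numeral\<close>)
    have "((\<lambda>lam. 4 * b' / (h'\<^sup>2 + lam powr (-4/3) * b'\<^sup>2) *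
       (b * (1 - lam powr (-4/3) * ((b\<^sup>2 - b'\<^sup>2) / h'\<^sup>2)) powr (-1/2) - b') *
       exp (- A_exponent lam (b, h) (b', h')))
      \<longlongrightarrow> 4 * b' / (h'\<^sup>2 + 0) * (b * (1 - 0) powr (-1/2) - b') *
        exp (- (2/3 * b ^ 3 * (1 / h' - 1 / h)))) at_top"
      by (intro tendsto_intros vanish A) (use pos in auto)
    moreover have "\<forall>\<^sub>F lam in at_top. p_lam lam (b, h) (b', h') =
       4 * b' / (h'\<^sup>2 + lam powr (-4/3) * b'\<^sup>2) *
       (b * (1 - lam powr (-4/3) * ((b\<^sup>2 - b'\<^sup>2) / h'\<^sup>2)) powr (-1/2) - b') *
       exp (- A_exponent lam (b, h) (b', h'))"
      using order_tendstoD(1)[OF upper 3(2)] order_tendstoD(2)[OF vanish(2) pos(4), of "sqrt (b\<^sup>2 - b'\<^sup>2)"]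
      by eventually_elim (use 3 pos in \<open>simp add: p_lam_def S_region_def\<close>)
    ultimately show ?thesis
      using 3 pos by (simp add: tendsto_cong p_inf_def mult_ac)
  qed
qed

section \<open>The law of one step\<close>

text \<open>Change of variables for densities. It is deduced from the theorem on absolutely integrable
  functions, applied for each event \<open>A\<close> to the function \<open>q\<close> cut off outside \<open>A\<close>. Letting \<open>f\<close> differ from
  \<open>0\<close> on a null set outside \<open>S\<close> makes it possible to remove the endpoint \<open>0\<close> of the
  exponential density.\<close>

lemma (in prob_space) distributed_transform:
  fixes X :: "'a \<Rightarrow> real" and f q \<phi> \<phi>' :: "real \<Rightarrow> real"
  assumes X: "distributed M lborel X (\<lambda>x. ennreal (f x))"
    and f [measurable]: "f \<in> borel_measurable borel" and f_nonneg: "\<And>x. 0 \<le> f x"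
    and S [measurable]: "S \<in> sets borel" and null: "AE x in lborel. x \<notin> S \<longrightarrow> f x = 0"
    and \<phi> [measurable]: "\<phi> \<in> borel_measurable borel"
    and deriv: "\<And>x. x \<in> S \<Longrightarrow> (\<phi> has_field_derivative \<phi>' x) (at x)"
    and inj: "inj_on \<phi> S"
    and q [measurable]: "q \<in> borel_measurable borel" and q_nonneg: "\<And>y. 0 \<le> q y"
    and jacobian: "\<And>x. x \<in> S \<Longrightarrow> \<bar>\<phi>' x\<bar> * q (\<phi> x) = f x"
    and q_null: "\<And>y. y \<notin> \<phi> ` S \<Longrightarrow> q y = 0"
  shows "distributed M lborel (\<lambda>\<omega>. \<phi> (X \<omega>)) (\<lambda>y. ennreal (q y))"
proof -
  have X_meas [measurable]: "X \<in> borel_measurable M"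
    using distributed_measurable[OF X] by simp
  have mass: "(\<integral>\<^sup>+x. ennreal (f x) \<partial>lborel) = 1"
    using distributed_emeasure[OF X, of UNIV] emeasure_space_1 by (simp add: space_lborel)
  have "distr M lborel (\<lambda>\<omega>. \<phi> (X \<omega>)) = density lborel (\<lambda>y. ennreal (q y))"
  proof (rule measure_eqI)
    fix A assume "A \<in> sets (distr M lborel (\<lambda>\<omega>. \<phi> (X \<omega>)))"
    then have A [measurable]: "A \<in> sets borel" by simp
    define G where "G x = indicator S x * (f x * indicator A (\<phi> x))" for x :: real
    define F where "F y = q y * indicator A y" for y :: real
    have [measurable]: "G \<in> borel_measurable borel" "F \<in> borel_measurable borel"
      unfolding G_def[abs_def] F_def[abs_def] by measurable
    have nonneg: "0 \<le> G x" "0 \<le> F x" for x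
      using f_nonneg q_nonneg by (auto simp: G_def F_def)
    have "integrable lborel f"
      by (rule integrableI_nonneg) (use f_nonneg mass in auto)
    then have G_int: "integrable lborel G"
      by (rule Bochner_Integration.integrable_bound)
         (auto simp: G_def f_nonneg split: split_indicator)
    have G_eq: "indicator S x *\<^sub>R (\<bar>\<phi>' x\<bar> * F (\<phi> x)) = G x" for x
      using jacobian[of x] by (auto simp: G_def F_def split: split_indicator)
    have S_int: "set_integrable lborel S (\<lambda>x. \<bar>\<phi>' x\<bar> * F (\<phi> x))"
      unfolding set_integrable_def G_eq by (rule G_int)
    have "(\<lambda>x. \<bar>\<phi>' x\<bar> * F (\<phi> x)) absolutely_integrable_on S"
      unfolding set_integrable_def G_eq using G_int by (simp add: integrable_completion)
    moreover have "integral S (\<lambda>x. \<bar>\<phi>' x\<bar> * F (\<phi> x)) = integral\<^sup>L lborel G"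
      using set_borel_integral_eq_integral(2)[OF S_int]
      by (simp add: set_lebesgue_integral_def G_eq[unfolded real_scaleR_def])
    ultimately have change: "F absolutely_integrable_on \<phi> ` S" "integral (\<phi> ` S) F = integral\<^sup>L lborel G"
      using has_absolute_integral_change_of_variables_1'[of S \<phi> \<phi>' F "integral\<^sup>L lborel G"]
        deriv inj S by (auto intro: has_field_derivative_at_within)
    have F_eq: "indicator (\<phi> ` S) y *\<^sub>R F y = F y" for y
      using q_null[of y] by (auto simp: F_def split: split_indicator)
    have F_int: "integrable lborel F"
      using change(1) by (simp add: set_integrable_def F_eq[unfolded real_scaleR_def] integrable_completion)
    have F_integral: "integral\<^sup>L lborel F = integral\<^sup>L lborel G"
      using set_lebesgue_integral_eq_integral(2)[OF change(1)] change(2)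
      by (simp add: set_lebesgue_integral_def F_eq[unfolded real_scaleR_def] integral_completion)
    have "emeasure (distr M lborel (\<lambda>\<omega>. \<phi> (X \<omega>))) A = emeasure (distr M lborel X) (\<phi> -` A)"
      using measurable_sets[OF \<phi> A]
      by (simp add: emeasure_distr vimage_def)
    also have "\<dots> = (\<integral>\<^sup>+x. ennreal (f x) * indicator (\<phi> -` A) x \<partial>lborel)"
      unfolding distributed_distr_eq_density[OF X] using measurable_sets[OF \<phi> A]
      by (intro emeasure_density) auto
    also have "\<dots> = (\<integral>\<^sup>+x. ennreal (G x) \<partial>lborel)"
      by (intro nn_integral_cong_AE, use null in eventually_elim)
         (auto simp: G_def split: split_indicator)
    also have "\<dots> = (\<integral>\<^sup>+y. ennreal (F y) \<partial>lborel)"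
      using nonneg F_int G_int F_integral by (simp add: nn_integral_eq_integral)
    also have "\<dots> = emeasure (density lborel (\<lambda>y. ennreal (q y))) A"
      by (subst emeasure_density) (auto simp: F_def intro!: nn_integral_cong split: split_indicator)
    finally show "emeasure (distr M lborel (\<lambda>\<omega>. \<phi> (X \<omega>))) A = emeasure (density lborel (\<lambda>y. ennreal (q y))) A" .
  qed simp
  then show ?thesis
    by (simp add: distributed_def)
qed

text \<open>State and driving variables are paired because measurability of the recursion is a statement
  about their product space.\<close>

fun step :: "(real \<times> real) \<times> (real \<times> real) \<Rightarrow> real \<times> real" where
  "step ((b, h), (r, t)) = (r * b, b ^ 3 * h / (b ^ 3 + 3/2 * t * h))"

lemma beta_density_2_2: "beta_density 2 2 x = indicator {0<..<1} x * (6 * x * (1 - x))"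
proof -
  have "Beta 2 2 = (1/6 :: real)"
    by (simp add: Beta_def Gamma_numeral fact_numeral)
  then show ?thesis
    unfolding beta_density_def \<open>Beta 2 2 = 1/6\<close> by (auto split: split_indicator)
qed

lemma (in prob_space) distributed_base_step:
  assumes r: "distributed M lborel r (\<lambda>x. ennreal (beta_density 2 2 x))" and b: "0 < b"
  shows "distributed M lborel (\<lambda>\<omega>. r \<omega> * b)
    (\<lambda>y. ennreal (indicator {0<..<b} y * (6 * y * (b - y) / b ^ 3)))"
proof (rule distributed_transform[OF r, where S = "{0<..<1}" and \<phi> = "\<lambda>x. x * b" and \<phi>' = "\<lambda>_. b"])
  show "y \<notin> (\<lambda>x. x * b) ` {0<..<1} \<Longrightarrow> indicator {0<..<b} y * (6 * y * (b - y) / b ^ 3) = 0" for y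
    using b by (auto simp: image_iff divide_simps split: split_indicator dest!: bspec[of _ _ "y / b"])
  show "\<bar>b\<bar> * (indicator {0<..<b} (x * b) * (6 * (x * b) * (b - x * b) / b ^ 3)) = beta_density 2 2 x"
    if "x \<in> {0<..<1}" for x
    using b that by (simp add: beta_density_2_2 field_simps eval_nat_numeral split: split_indicator)
qed (use b in \<open>auto simp: beta_density_2_2 inj_on_def intro!: derivative_eq_intros split: split_indicator\<close>)

lemma (in prob_space) distributed_height_step:
  assumes t: "distributed M lborel t (\<lambda>x. ennreal (exponential_density 1 x))" and pos: "0 < b" "0 < h"
  shows "distributed M lborel (\<lambda>\<omega>. b ^ 3 * h / (b ^ 3 + 3/2 * t \<omega> * h))
    (\<lambda>y. ennreal (indicator {0<..<h} y * (2/3 * b ^ 3 / y\<^sup>2 * exp (- (2/3) * b ^ 3 * (1 / y - 1 / h)))))"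
proof (rule distributed_transform[OF t, where S = "{0<..}" and \<phi> = "\<lambda>x. b ^ 3 * h / (b ^ 3 + 3/2 * x * h)"
    and \<phi>' = "\<lambda>x. - (b ^ 3 * h * (3/2 * h)) / (b ^ 3 + 3/2 * x * h)\<^sup>2"])
  let ?\<phi> = "\<lambda>x. b ^ 3 * h / (b ^ 3 + 3/2 * x * h)"
  have den: "0 < b ^ 3 + 3/2 * x * h" if "0 < x" for x
    using pos that by (simp add: add_pos_pos)
  show "AE x in lborel. x \<notin> {0<..} \<longrightarrow> exponential_density 1 x = 0"
    using AE_lborel_singleton[of "0::real"] by eventually_elim (auto simp: exponential_density_def)
  show "(?\<phi> has_field_derivative - (b ^ 3 * h * (3/2 * h)) / (b ^ 3 + 3/2 * x * h)\<^sup>2) (at x)"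
    if "x \<in> {0<..}" for x
    using den[of x] that by (auto intro!: derivative_eq_intros simp: power2_eq_square)
  show "inj_on ?\<phi> {0<..}"
  proof (rule inj_onI)
    fix x y assume xy: "x \<in> {0<..}" "y \<in> {0<..}" "?\<phi> x = ?\<phi> y"
    then have "b ^ 3 + 3/2 * x * h = b ^ 3 + 3/2 * y * h"
      using den[of x] den[of y] pos by (simp add: frac_eq_eq)
    then show "x = y" using pos by simp
  qed
  show "\<bar>- (b ^ 3 * h * (3/2 * h)) / (b ^ 3 + 3/2 * x * h)\<^sup>2\<bar> *
     (indicator {0<..<h} (?\<phi> x) * (2/3 * b ^ 3 / (?\<phi> x)\<^sup>2 * exp (- (2/3) * b ^ 3 * (1 / ?\<phi> x - 1 / h))))
     = exponential_density 1 x" if "x \<in> {0<..}" for x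
  proof -
    have x: "0 < x" using that by simp
    note d = den[OF x]
    have "?\<phi> x \<in> {0<..<h}"
      using d x pos by (simp add: divide_simps)
    moreover have "- (2/3) * b ^ 3 * (1 / ?\<phi> x - 1 / h) = - x"
      using d x pos by (simp add: field_simps)
    moreover have "\<bar>- (b ^ 3 * h * (3/2 * h)) / (b ^ 3 + 3/2 * x * h)\<^sup>2\<bar> * (2/3 * b ^ 3 / (?\<phi> x)\<^sup>2) = 1"
    proof -
      have "(b ^ 3 * h * (3/2 * h)) / D\<^sup>2 * (2/3 * b ^ 3 / (b ^ 3 * h / D)\<^sup>2) = 1" if "0 < D" for D
        using that pos by (simp add: field_simps power2_eq_square)
      from this[OF d] show ?thesis using pos by (simp add: abs_divide)
    qed
    ultimately show ?thesis
      using x by (simp add: exponential_density_def flip: mult.assoc)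
  qed
  show "indicator {0<..<h} y * (2/3 * b ^ 3 / y\<^sup>2 * exp (- (2/3) * b ^ 3 * (1 / y - 1 / h))) = 0"
    if "y \<notin> ?\<phi> ` {0<..}" for y
  proof -
    have "y \<in> ?\<phi> ` {0<..}" if y: "y \<in> {0<..<h}"
    proof (rule image_eqI)
      \<comment> \<open>The preimage solves \<open>1 / y = 1 / h + 3/2 * x / b ^ 3\<close>.\<close>
      show "y = ?\<phi> (2/3 * b ^ 3 * (1 / y - 1 / h))" using y pos by (simp add: field_simps)
      show "2/3 * b ^ 3 * (1 / y - 1 / h) \<in> {0<..}" using y pos by (simp add: divide_simps)
    qed
    then show ?thesis using that by (auto split: split_indicator)
  qed
qed (use pos in \<open>auto simp: exponential_density_def\<close>)

text \<open>Half-base and height after one step are functions of two independent variables, so their joint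
  density is a product; this is the whole reason why \<^const>\<open>p_inf\<close> is the kernel of the recursion.\<close>

lemma (in prob_space) distr_step_eq_density_kernel:
  assumes r: "distributed M lborel r (\<lambda>x. ennreal (beta_density 2 2 x))"
    and t: "distributed M lborel t (\<lambda>x. ennreal (exponential_density 1 x))"
    and indep: "indep_var borel r borel t"
    and pos: "0 < b" "0 < h"
  shows "distr M borel (\<lambda>\<omega>. step ((b, h), (r \<omega>, t \<omega>))) = density_kernel p_inf (b, h)"
proof -
  have "indep_var lborel (\<lambda>\<omega>. r \<omega> * b) lborel (\<lambda>\<omega>. b ^ 3 * h / (b ^ 3 + 3/2 * t \<omega> * h))"
    using indep_var_compose[OF indep, of "\<lambda>x. x * b" lborel "\<lambda>x. b ^ 3 * h / (b ^ 3 + 3/2 * x * h)" lborel]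
    by (simp add: comp_def)
  from distributed_joint_indep[OF lborel.sigma_finite_measure_axioms lborel.sigma_finite_measure_axioms
    distributed_base_step[OF r pos(1)] distributed_height_step[OF t pos] this]
  have "distr M lborel (\<lambda>\<omega>. step ((b, h), (r \<omega>, t \<omega>))) = density lborel
    (\<lambda>(x, y). ennreal (indicator {0<..<b} x * (6 * x * (b - x) / b ^ 3)) *
      ennreal (indicator {0<..<h} y * (2/3 * b ^ 3 / y\<^sup>2 * exp (- (2/3) * b ^ 3 * (1 / y - 1 / h)))))"
    by (simp add: distributed_def lborel_prod)
  also have "\<dots> = density_kernel p_inf (b, h)"
    unfolding density_kernel_def
  proof (rule arg_cong[where f = "density lborel"], rule ext)
    fix z :: "real \<times> real"
    obtain x y where z: "z = (x, y)" by fastforce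
    show "(case z of (x, y) \<Rightarrow> ennreal (indicator {0<..<b} x * (6 * x * (b - x) / b ^ 3)) *
      ennreal (indicator {0<..<h} y * (2/3 * b ^ 3 / y\<^sup>2 * exp (- (2/3) * b ^ 3 * (1 / y - 1 / h)))))
      = ennreal (p_inf (b, h) z)"
      unfolding z p_inf_def using pos
      by (auto simp: field_simps split: split_indicator simp flip: ennreal_mult)
  qed
  finally show ?thesis
    by (simp cong: distr_cong)
qed

section \<open>Natural filtrations up to null sets\<close>

lemma space_natural_filtration [simp]: "space (natural_filtration M X n) = space M"
  by (auto simp: natural_filtration_def space_measure_of_conv)

lemma sets_natural_filtration:
  "sets (natural_filtration M X n) =
    sigma_sets (space M) (\<Union>i\<le>n. {X i -` A \<inter> space M |A. A \<in> sets borel})"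
  unfolding natural_filtration_def by (rule sets_measure_of) auto

lemma sets_natural_filtration_subset:
  assumes "sigma_algebra (space M) N"
    and "\<And>i A. i \<le> n \<Longrightarrow> A \<in> sets borel \<Longrightarrow> X i -` A \<inter> space M \<in> N"
  shows "sets (natural_filtration M X n) \<subseteq> N"
  unfolding sets_natural_filtration
  by (rule sigma_algebra.sigma_sets_subset[OF assms(1)]) (use assms(2) in auto)

lemma subalgebra_natural_filtration:
  assumes "\<And>i. X i \<in> borel_measurable M"
  shows "subalgebra M (natural_filtration M X n)"
  using sets_natural_filtration_subset[OF sets.sigma_algebra_axioms, of n X M] assms
  by (auto simp: subalgebra_def intro: measurable_sets)

lemma measurable_natural_filtration: "i \<le> n \<Longrightarrow> X i \<in> borel_measurable (natural_filtration M X n)"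
  by (rule measurableI) (auto simp: sets_natural_filtration intro: sigma_sets.Basic)

text \<open>The generating events, those that agree almost surely with an event of \<open>G\<close>, already form a
  \<open>\<sigma>\<close>-algebra if \<open>G\<close> is a subalgebra of \<open>M\<close>; \<^const>\<open>sigma\<close> only packages them as a measure space.\<close>

definition null_augmentation :: "'w measure \<Rightarrow> 'w measure \<Rightarrow> 'w measure" where
  "null_augmentation M G =
     sigma (space M) {D \<in> sets M. \<exists>D'\<in>sets G. AE \<omega> in M. \<omega> \<in> D \<longleftrightarrow> \<omega> \<in> D'}"

lemma space_null_augmentation [simp]: "space (null_augmentation M G) = space M"
  by (auto simp: null_augmentation_def space_measure_of_conv)

lemma sets_null_augmentation:
  assumes sub: "subalgebra M G"
  shows "sets (null_augmentation M G) =
    {D \<in> sets M. \<exists>D'\<in>sets G. AE \<omega> in M. \<omega> \<in> D \<longleftrightarrow> \<omega> \<in> D'}" (is "_ = ?N")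
proof -
  have "sigma_algebra (space M) ?N"
    unfolding sigma_algebra_iff2
  proof (intro conjI ballI allI impI)
    show "?N \<subseteq> Pow (space M)" using sets.sets_into_space by auto
    show "{} \<in> ?N" by auto
    fix D assume "D \<in> ?N"
    then obtain D' where D: "D \<in> sets M" "D' \<in> sets G" "AE \<omega> in M. \<omega> \<in> D \<longleftrightarrow> \<omega> \<in> D'" by auto
    have "space M - D' \<in> sets G"
      using D(2) sub sets.compl_sets[of D' G] by (simp add: subalgebra_def)
    moreover have "AE \<omega> in M. \<omega> \<in> space M - D \<longleftrightarrow> \<omega> \<in> space M - D'"
      using D(3) by eventually_elim auto
    ultimately show "space M - D \<in> ?N"
      using D(1) by (intro CollectI conjI bexI[of _ "space M - D'"]) auto
  next
    fix D :: "nat \<Rightarrow> 'a set" assume "range D \<subseteq> ?N"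
    then have "D i \<in> ?N" for i by (rule subsetD) simp
    then have "\<forall>i. \<exists>D'. D i \<in> sets M \<and> D' \<in> sets G \<and> (AE \<omega> in M. \<omega> \<in> D i \<longleftrightarrow> \<omega> \<in> D')" by blast
    then obtain D' where D: "\<And>i. D i \<in> sets M" "\<And>i. D' i \<in> sets G"
      "\<And>i. AE \<omega> in M. \<omega> \<in> D i \<longleftrightarrow> \<omega> \<in> D' i" by metis
    have "AE \<omega> in M. \<forall>i. \<omega> \<in> D i \<longleftrightarrow> \<omega> \<in> D' i" using D(3) by (simp add: AE_all_countable)
    then have "AE \<omega> in M. \<omega> \<in> (\<Union>i. D i) \<longleftrightarrow> \<omega> \<in> (\<Union>i. D' i)" by eventually_elim auto
    moreover have "(\<Union>i. D i) \<in> sets M" "(\<Union>i. D' i) \<in> sets G" using D by auto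
    ultimately show "(\<Union>i. D i) \<in> ?N" by blast
  qed
  then show ?thesis
    unfolding null_augmentation_def by (rule sigma_algebra.sets_measure_of_eq)
qed

text \<open>This is what the augmentation is for: a variable may be modified on a null set without
  losing its measurability.\<close>

lemma measurable_null_augmentation_cong:
  assumes sub: "subalgebra M G"
    and Y: "Y \<in> measurable (null_augmentation M G) N"
    and Z: "Z \<in> measurable M N"
    and eq: "AE \<omega> in M. Z \<omega> = Y \<omega>"
  shows "Z \<in> measurable (null_augmentation M G) N"
proof (rule measurableI)
  show "Z \<omega> \<in> space N" if "\<omega> \<in> space (null_augmentation M G)" for \<omega>
    using measurable_space[OF Z] that by simp
  fix A assume A: "A \<in> sets N"
  obtain D' where D': "D' \<in> sets G" "AE \<omega> in M. \<omega> \<in> Y -` A \<inter> space M \<longleftrightarrow> \<omega> \<in> D'"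
    using measurable_sets[OF Y A] by (auto simp: sets_null_augmentation[OF sub])
  have "AE \<omega> in M. \<omega> \<in> Z -` A \<inter> space M \<longleftrightarrow> \<omega> \<in> D'"
    using D'(2) eq by eventually_elim auto
  then show "Z -` A \<inter> space (null_augmentation M G) \<in> sets (null_augmentation M G)"
    using measurable_sets[OF Z A] D'(1) by (auto simp: sets_null_augmentation[OF sub])
qed

lemma measurable_null_augmentationI:
  assumes sub: "subalgebra M G" and le: "sets G' \<subseteq> sets G" "space G' = space M"
    and Y: "Y \<in> measurable G' N"
  shows "Y \<in> measurable (null_augmentation M G) N"
proof (rule measurableI)
  show "Y \<omega> \<in> space N" if "\<omega> \<in> space (null_augmentation M G)" for \<omega>
    using measurable_space[OF Y] that le by simp
  show "Y -` A \<inter> space (null_augmentation M G) \<in> sets (null_augmentation M G)" if "A \<in> sets N" for A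
  proof -
    have "Y -` A \<inter> space M \<in> sets G" using measurable_sets[OF Y that] le by auto
    moreover from this have "Y -` A \<inter> space M \<in> sets M" using sub by (auto simp: subalgebra_def)
    ultimately show ?thesis
      unfolding sets_null_augmentation[OF sub] space_null_augmentation
      by (intro CollectI conjI bexI[of _ "Y -` A \<inter> space M"]) auto
  qed
qed

lemma (in prob_space) indep_set_mono:
  assumes indep: "indep_set A B" and sub: "A' \<subseteq> A" "B' \<subseteq> B"
  shows "indep_set A' B'"
proof (rule indep_setI)
  show "A' \<subseteq> events" using sub(1) indep_setD_ev1[OF indep] by (rule order_trans)
  show "B' \<subseteq> events" using sub(2) indep_setD_ev2[OF indep] by (rule order_trans)
  show "prob (a \<inter> b) = prob a * prob b" if "a \<in> A'" "b \<in> B'" for a b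
    using that sub by (intro indep_setD[OF indep]) (auto dest: subsetD)
qed

lemma (in prob_space) indep_set_null_augmentation:
  assumes sub: "subalgebra M G" and indep: "indep_set (sets G) C"
  shows "indep_set (sets (null_augmentation M G)) C"
proof (rule indep_setI)
  show "sets (null_augmentation M G) \<subseteq> events" by (auto simp: sets_null_augmentation[OF sub])
  show C: "C \<subseteq> events" by (rule indep_setD_ev2[OF indep])
  fix D c assume "D \<in> sets (null_augmentation M G)" and c: "c \<in> C"
  then obtain D' where D: "D \<in> events" "D' \<in> sets G" "AE \<omega> in M. \<omega> \<in> D \<longleftrightarrow> \<omega> \<in> D'"
    by (auto simp: sets_null_augmentation[OF sub])
  have ev: "D' \<in> events" "c \<in> events" using D(2) sub c C by (auto simp: subalgebra_def)
  have "prob (D \<inter> c) = prob (D' \<inter> c)"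
    by (rule finite_measure_eq_AE) (use D ev in \<open>auto elim: eventually_mono\<close>)
  also have "\<dots> = prob D' * prob c" by (rule indep_setD[OF indep D(2) c])
  also have "prob D' = prob D"
    by (rule finite_measure_eq_AE) (use D ev in \<open>auto elim: eventually_mono\<close>)
  finally show "prob (D \<inter> c) = prob D * prob c" .
qed

section \<open>Markov chains defined by random recursions\<close>

text \<open>By induction along the recursion, \<open>X i\<close> for \<open>i \<le> n\<close> is measurable with respect to the
  null augmentation of \<open>G n\<close>. Hence the past of \<open>X\<close> inherits the independence from \<open>G n\<close>.\<close>

lemma (in prob_space) indep_set_natural_filtration_recursion:
  fixes X :: "nat \<Rightarrow> 'a \<Rightarrow> 's::topological_space" and W :: "nat \<Rightarrow> 'a \<Rightarrow> 'e::topological_space"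
  assumes f: "f \<in> borel \<Otimes>\<^sub>M borel \<rightarrow>\<^sub>M borel"
    and X: "\<And>n. X n \<in> borel_measurable M"
    and recursion: "\<And>n. AE \<omega> in M. X (Suc n) \<omega> = f (X n \<omega>, W n \<omega>)"
    and sub: "\<And>n. subalgebra M (G n)" and mono: "\<And>m n. m \<le> n \<Longrightarrow> sets (G m) \<subseteq> sets (G n)"
    and X0: "X 0 \<in> borel_measurable (G 0)"
    and W: "\<And>n. W n \<in> borel_measurable (G (Suc n))"
    and indep: "indep_set (sets (G n)) C"
  shows "indep_set (sets (natural_filtration M X n)) C"
proof -
  have space_G: "space (G m) = space M" for m using sub[of m] by (simp add: subalgebra_def)
  have adapted: "X i \<in> borel_measurable (null_augmentation M (G n))" if "i \<le> n" for i n
    using that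
  proof (induction i)
    case 0
    show ?case by (rule measurable_null_augmentationI[OF sub mono[of 0 n] space_G X0]) simp
  next
    case (Suc i)
    have [measurable]: "X i \<in> borel_measurable (null_augmentation M (G n))"
      using Suc by simp
    have [measurable]: "W i \<in> borel_measurable (null_augmentation M (G n))"
      by (rule measurable_null_augmentationI[OF sub mono[OF Suc.prems] space_G W])
    note f [measurable]
    have "(\<lambda>\<omega>. f (X i \<omega>, W i \<omega>)) \<in> borel_measurable (null_augmentation M (G n))"
      by measurable
    then show ?case
      by (rule measurable_null_augmentation_cong[OF sub _ X recursion])
  qed
  have "sets (natural_filtration M X n) \<subseteq> sets (null_augmentation M (G n))"
  proof (rule sets_natural_filtration_subset)
    show "sigma_algebra (space M) (sets (null_augmentation M (G n)))"
      using sets.sigma_algebra_axioms[of "null_augmentation M (G n)"] by simp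
    show "X i -` A \<inter> space M \<in> sets (null_augmentation M (G n))" if "i \<le> n" "A \<in> sets borel" for i A
      using measurable_sets[OF adapted[OF that(1)] that(2)] by simp
  qed
  then show ?thesis
    by (rule indep_set_mono[OF indep_set_null_augmentation[OF sub indep] _ order_refl])
qed

text \<open>The conditional law is found by testing against an event \<open>D\<close> of the past. The identity map from \<open>M\<close>
  to the past is a random element independent of \<open>W n\<close>, so the joint law of \<open>(\<omega>, W n \<omega>)\<close>
  is a product, and Fubini's theorem integrates \<open>W n\<close> out for fixed \<open>\<omega>\<close>; this leaves \<open>K (X n \<omega>)\<close>.\<close>

lemma (in prob_space) markov_chain_random_recursion:
  fixes X :: "nat \<Rightarrow> 'a \<Rightarrow> 's::topological_space" and W :: "nat \<Rightarrow> 'a \<Rightarrow> 'e::topological_space"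
  assumes E [measurable]: "E \<in> sets borel"
    and f [measurable]: "f \<in> borel \<Otimes>\<^sub>M borel \<rightarrow>\<^sub>M borel"
    and X [measurable]: "\<And>n. X n \<in> borel_measurable M"
    and W [measurable]: "\<And>n. W n \<in> borel_measurable M"
    and init: "AE \<omega> in M. X 0 \<omega> \<in> E"
    and recursion: "\<And>n. AE \<omega> in M. X (Suc n) \<omega> = f (X n \<omega>, W n \<omega>)"
    and indep: "\<And>n. indep_set (sets (natural_filtration M X n)) {W n -` A \<inter> space M |A. A \<in> sets borel}"
    and stays: "\<And>n. AE \<omega> in M. \<forall>x\<in>E. f (x, W n \<omega>) \<in> E"
    and law: "\<And>n x. x \<in> E \<Longrightarrow> distr M borel (\<lambda>\<omega>. f (x, W n \<omega>)) = K x"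
  shows "markov_chain_with_kernel M E K X"
  unfolding markov_chain_with_kernel_def
proof (intro conjI allI ballI)
  have K_meas: "K \<in> restrict_space borel E \<rightarrow>\<^sub>M prob_algebra borel"
  proof -
    have K_eq: "K x = distr (distr M borel (W 0)) borel (\<lambda>w. f (x, w))" if "x \<in> space (restrict_space borel E)" for x
      using that law[of x 0] by (subst distr_distr) (auto simp: space_restrict_space comp_def)
    have id_E: "(\<lambda>x. x) \<in> restrict_space borel E \<rightarrow>\<^sub>M borel"
      by (rule measurable_restrict_space1) simp
    have [measurable]: "fst \<in> restrict_space borel E \<Otimes>\<^sub>M borel \<rightarrow>\<^sub>M borel"
      by (rule measurable_compose[OF measurable_fst id_E])
    have f_E: "(\<lambda>z. f (fst z, snd z)) \<in> restrict_space borel E \<Otimes>\<^sub>M borel \<rightarrow>\<^sub>M borel"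
      by (rule measurable_compose[OF _ f]) measurable
    have "distr M borel (W 0) \<in> space (prob_algebra borel)"
      by (simp add: space_prob_algebra prob_space_distr)
    then have "(\<lambda>x. distr (distr M borel (W 0)) borel (\<lambda>w. f (x, w))) \<in> restrict_space borel E \<rightarrow>\<^sub>M prob_algebra borel"
      by (intro measurable_distr_prob_space2[where M = borel]) (use f_E in \<open>simp_all add: case_prod_beta'\<close>)
    then show ?thesis by (subst measurable_cong[OF K_eq])
  qed
  show "transition_kernel_on E K"
    unfolding transition_kernel_on_def
  proof (intro conjI ballI K_meas)
    fix x assume x: "x \<in> E"
    show "AE y in K x. y \<in> E"
      unfolding law[OF x, symmetric, of 0] using stays[of 0] x
      by (subst AE_distr_iff) (auto elim: eventually_mono)
  qed
  show in_E: "AE \<omega> in M. X n \<omega> \<in> E" for n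
  proof (induction n)
    case (Suc n)
    from Suc recursion[of n] stays[of n] show ?case by eventually_elim auto
  qed (rule init)
  fix n and A :: "'s set" assume A [measurable]: "A \<in> sets borel"
  let ?F = "natural_filtration M X n"
  have sub: "subalgebra M ?F" by (rule subalgebra_natural_filtration[OF X])
  interpret finite_measure_subalgebra M ?F by standard (rule sub)
  have X_F [measurable]: "X n \<in> borel_measurable ?F" by (rule measurable_natural_filtration) simp
  \<comment> \<open>The kernel is measurable on \<open>E\<close> only, so it is cut off outside \<open>E\<close> to get a variable that is
    measurable with respect to the past.\<close>
  define g where "g \<omega> = (if X n \<omega> \<in> E then measure (K (X n \<omega>)) A else 0)" for \<omega>
  have prob_K: "prob_space (K x)" "sets (K x) = sets borel" if "x \<in> E" for x
    using measurable_space[OF K_meas, of x] that by (auto simp: space_prob_algebra space_restrict_space)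
  have g_bound: "0 \<le> g \<omega>" "g \<omega> \<le> 1" for \<omega>
    using prob_space.prob_le_1[OF prob_K(1)] by (auto simp: g_def)
  have g_F [measurable]: "g \<in> borel_measurable ?F"
  proof -
    have "(\<lambda>x. measure (K x) A) \<in> borel_measurable (restrict_space borel E)"
      by (rule measurable_compose[OF measurable_prob_algebraD[OF K_meas] measurable_measure_subprob_algebra[OF A]])
    then have "(\<lambda>x. if x \<in> E then measure (K x) A else 0) \<in> borel_measurable borel"
      by (subst (asm) measurable_restrict_space_iff[where c = 0]) auto
    then show ?thesis unfolding g_def[abs_def] by (rule measurable_compose[OF X_F])
  qed
  have g_M [measurable]: "g \<in> borel_measurable M" by (rule measurable_from_subalg[OF sub g_F])
  have id_F [measurable]: "(\<lambda>\<omega>. \<omega>) \<in> M \<rightarrow>\<^sub>M ?F" 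
    by (rule measurableI) (use sub in \<open>auto simp: subalgebra_def\<close>)
  have joint: "distr M ?F (\<lambda>\<omega>. \<omega>) \<Otimes>\<^sub>M distr M borel (W n) = distr M (?F \<Otimes>\<^sub>M borel) (\<lambda>\<omega>. (\<omega>, W n \<omega>))"
  proof (rule pair_measure_eqI)
    interpret D1: prob_space "distr M ?F (\<lambda>\<omega>. \<omega>)" by (rule prob_space_distr[OF id_F])
    interpret D2: prob_space "distr M borel (W n)" by (rule prob_space_distr[OF W])
    show "sigma_finite_measure (distr M ?F (\<lambda>\<omega>. \<omega>))" "sigma_finite_measure (distr M borel (W n))" ..
    fix D A' assume "D \<in> sets (distr M ?F (\<lambda>\<omega>. \<omega>))" "A' \<in> sets (distr M borel (W n))"
    then have D [measurable]: "D \<in> sets ?F" and A' [measurable]: "A' \<in> sets borel" by simp_all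
    have "D \<inter> space M = D" using sets.sets_into_space[OF D] by auto
    then have "prob ((\<lambda>\<omega>. (\<omega>, W n \<omega>)) -` (D \<times> A') \<inter> space M) = prob (D \<inter> (W n -` A' \<inter> space M))"
      by (intro arg_cong[where f = prob]) auto
    also have "\<dots> = prob D * prob (W n -` A' \<inter> space M)"
      using indep[of n] D A' by (intro indep_setD) auto
    finally show "emeasure (distr M ?F (\<lambda>\<omega>. \<omega>)) D * emeasure (distr M borel (W n)) A' =
        emeasure (distr M (?F \<Otimes>\<^sub>M borel) (\<lambda>\<omega>. (\<omega>, W n \<omega>))) (D \<times> A')"
      using \<open>D \<inter> space M = D\<close>
      by (simp add: emeasure_distr emeasure_eq_measure ennreal_mult)
  qed simp
  have conditional: "AE \<omega> in M. real_cond_exp M ?F (\<lambda>\<omega>. indicator A (X (Suc n) \<omega>)) \<omega> = g \<omega>"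
  proof (rule real_cond_exp_charact)
    show int_ind: "integrable M (\<lambda>\<omega>. indicator A (X (Suc n) \<omega>) :: real)"
      by (rule integrable_const_bound[where B = 1]) auto
    show int_g: "integrable M g"
      by (rule integrable_const_bound[where B = 1]) (use g_bound in auto)
    fix D assume D [measurable]: "D \<in> sets ?F"
    have D_M [measurable]: "D \<in> sets M" using D sub by (auto simp: subalgebra_def)
    interpret W: prob_space "distr M borel (W n)" by (rule prob_space_distr) measurable
    have "(\<integral>\<^sup>+\<omega>. ennreal (indicator D \<omega> * indicator A (X (Suc n) \<omega>)) \<partial>M) =
      (\<integral>\<^sup>+\<omega>. indicator D \<omega> * indicator A (f (X n \<omega>, W n \<omega>)) \<partial>M)"
      by (intro nn_integral_cong_AE, use recursion[of n] in eventually_elim) (auto split: split_indicator)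
    also have "\<dots> = (\<integral>\<^sup>+z. indicator D (fst z) * indicator A (f (X n (fst z), snd z)) \<partial>distr M (?F \<Otimes>\<^sub>M borel) (\<lambda>\<omega>. (\<omega>, W n \<omega>)))"
      by (subst nn_integral_distr) auto
    also have "\<dots> = (\<integral>\<^sup>+\<omega>. \<integral>\<^sup>+w. indicator D \<omega> * indicator A (f (X n \<omega>, w)) \<partial>distr M borel (W n) \<partial>distr M ?F (\<lambda>\<omega>. \<omega>))"
      unfolding joint[symmetric] by (subst W.nn_integral_fst[symmetric]) auto
    also have "\<dots> = (\<integral>\<^sup>+\<omega>. indicator D \<omega> * emeasure (distr M borel (\<lambda>\<omega>'. f (X n \<omega>, W n \<omega>'))) A \<partial>distr M ?F (\<lambda>\<omega>. \<omega>))"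
    proof (intro nn_integral_cong)
      fix \<omega>
      have [measurable]: "(\<lambda>w. f (X n \<omega>, w)) \<in> borel_measurable borel" by measurable
      have "(\<integral>\<^sup>+w. indicator A (f (X n \<omega>, w)) \<partial>distr M borel (W n)) = (\<integral>\<^sup>+y. indicator A y \<partial>distr M borel (\<lambda>\<omega>'. f (X n \<omega>, W n \<omega>')))"
        by (simp add: nn_integral_distr del: nn_integral_indicator)
      then show "(\<integral>\<^sup>+w. indicator D \<omega> * indicator A (f (X n \<omega>, w)) \<partial>distr M borel (W n)) =
        indicator D \<omega> * emeasure (distr M borel (\<lambda>\<omega>'. f (X n \<omega>, W n \<omega>'))) A"
        by (simp add: nn_integral_cmult)
    qed
    also have "\<dots> = (\<integral>\<^sup>+\<omega>. ennreal (indicator D \<omega> * g \<omega>) \<partial>distr M ?F (\<lambda>\<omega>. \<omega>))"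
    proof (rule nn_integral_cong_AE)
      have "AE \<omega> in distr M ?F (\<lambda>\<omega>. \<omega>). X n \<omega> \<in> E"
        using in_E[of n] measurable_sets[OF X_F E] by (subst AE_distr_iff[OF id_F]) (auto simp: vimage_def Int_def conj_commute)
      then show "AE \<omega> in distr M ?F (\<lambda>\<omega>. \<omega>). indicator D \<omega> * emeasure (distr M borel (\<lambda>\<omega>'. f (X n \<omega>, W n \<omega>'))) A =
        ennreal (indicator D \<omega> * g \<omega>)"
        by eventually_elim
           (auto simp: law g_def split: split_indicator
             intro!: finite_measure.emeasure_eq_measure prob_space.finite_measure prob_K)
    qed
    also have "\<dots> = (\<integral>\<^sup>+\<omega>. ennreal (indicator D \<omega> * g \<omega>) \<partial>M)"
      by (subst nn_integral_distr) auto
    finally have nn: "(\<integral>\<^sup>+\<omega>. ennreal (indicator D \<omega> * indicator A (X (Suc n) \<omega>)) \<partial>M) =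
      (\<integral>\<^sup>+\<omega>. ennreal (indicator D \<omega> * g \<omega>) \<partial>M)" .
    have "(\<integral>\<omega>. indicator D \<omega> * indicator A (X (Suc n) \<omega>) \<partial>M) = (\<integral>\<omega>. indicator D \<omega> * g \<omega> \<partial>M)"
      by (subst (1 2) integral_eq_nn_integral) (use nn g_bound in auto)
    then show "(\<integral>\<omega>\<in>D. indicator A (X (Suc n) \<omega>) \<partial>M) = (\<integral>\<omega>\<in>D. g \<omega> \<partial>M)"
      by (simp add: set_lebesgue_integral_def)
  qed (rule g_F)
  show "AE \<omega> in M. real_cond_exp M ?F (\<lambda>\<omega>. indicator A (X (Suc n) \<omega>)) \<omega> = measure (K (X n \<omega>)) A"
    using conditional in_E[of n] by eventually_elim (simp add: g_def)
qed (rule X)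

section \<open>Independence of the driving variables\<close>

text \<open>Joining two independent families that are independent of each other as wholes: a finite
  intersection splits into one block for each family, and the cross independence separates the blocks.\<close>

lemma (in prob_space) indep_sets_Un:
  assumes I: "indep_sets E I" and J: "indep_sets E J"
    and cross: "indep_set (sigma_sets (space M) (\<Union>i\<in>I. E i)) (sigma_sets (space M) (\<Union>j\<in>J. E j))"
    and disjoint: "I \<inter> J = {}"
  shows "indep_sets E (I \<union> J)"
proof (rule indep_setsI)
  have block: "(\<Inter>i\<in>L. A i) \<in> sigma_sets (space M) (\<Union>i\<in>I. E i)"
    if "indep_sets E I" "L \<subseteq> I" "L \<noteq> {}" "finite L" "\<forall>i\<in>L. A i \<in> E i" for L I A
  proof -
    have "(\<Union>i\<in>I. E i) \<subseteq> events" using that(1) by (auto simp: indep_sets_def)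
    also have "\<dots> \<subseteq> Pow (space M)" by (rule sets.space_closed)
    finally interpret sigma_algebra "space M" "sigma_sets (space M) (\<Union>i\<in>I. E i)"
      by (rule sigma_algebra_sigma_sets)
    show ?thesis
      using that by (intro finite_INT) (auto intro!: sigma_sets.Basic)
  qed
  fix A K assume K: "K \<noteq> {}" "K \<subseteq> I \<union> J" "finite K" "\<forall>k\<in>K. A k \<in> E k"
  have split: "K = (K \<inter> I) \<union> (K \<inter> J)" "(K \<inter> I) \<inter> (K \<inter> J) = {}" using K(2) disjoint by auto
  consider "K \<inter> I = {}" | "K \<inter> J = {}" | "K \<inter> I \<noteq> {}" "K \<inter> J \<noteq> {}" by blast
  then show "prob (\<Inter>k\<in>K. A k) = (\<Prod>k\<in>K. prob (A k))"
  proof cases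
    case 1
    then show ?thesis using K split by (intro indep_setsD[OF J]) auto
  next
    case 2
    then show ?thesis using K split by (intro indep_setsD[OF I]) auto
  next
    case 3
    have "prob (\<Inter>k\<in>K. A k) = prob ((\<Inter>k\<in>K \<inter> I. A k) \<inter> (\<Inter>k\<in>K \<inter> J. A k))"
      by (subst split(1)) (simp only: INT_Un)
    also have "\<dots> = prob (\<Inter>k\<in>K \<inter> I. A k) * prob (\<Inter>k\<in>K \<inter> J. A k)"
      by (intro indep_setD[OF cross] block[OF I] block[OF J]) (use 3 K in auto)
    also have "prob (\<Inter>k\<in>K \<inter> I. A k) = (\<Prod>k\<in>K \<inter> I. prob (A k))"
      by (intro indep_setsD[OF I]) (use 3 K in auto)
    also have "prob (\<Inter>k\<in>K \<inter> J. A k) = (\<Prod>k\<in>K \<inter> J. prob (A k))"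
      by (intro indep_setsD[OF J]) (use 3 K in auto)
    also have "(\<Prod>k\<in>K \<inter> I. prob (A k)) * (\<Prod>k\<in>K \<inter> J. prob (A k)) = (\<Prod>k\<in>K. prob (A k))"
      by (subst (3) split(1), subst prod.union_disjoint) (use K split(2) in auto)
    finally show ?thesis .
  qed
qed (use I J in \<open>auto simp: indep_sets_def\<close>)

text \<open>Index type for the sources of randomness, so that the initial state, the \<open>\<beta> n\<close> and the \<open>\<xi> n\<close> can be
  treated as a single family although their values lie in different types.\<close>

datatype source = Initial | Ratio nat | Waiting nat

fun source_events :: "'w measure \<Rightarrow> ('w \<Rightarrow> real \<times> real) \<Rightarrow> (nat \<Rightarrow> 'w \<Rightarrow> real) \<Rightarrow> (nat \<Rightarrow> 'w \<Rightarrow> real) \<Rightarrow>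
    source \<Rightarrow> 'w set set" where
  "source_events M X0 \<beta> \<xi> Initial = {X0 -` A \<inter> space M |A. A \<in> sets borel}"
| "source_events M X0 \<beta> \<xi> (Ratio n) = {\<beta> n -` A \<inter> space M |A. A \<in> sets borel}"
| "source_events M X0 \<beta> \<xi> (Waiting n) = {\<xi> n -` A \<inter> space M |A. A \<in> sets borel}"

lemma Int_stable_preimages: "Int_stable {X -` A \<inter> S |A. A \<in> sets N}"
proof (rule Int_stableI)
  fix a b assume "a \<in> {X -` A \<inter> S |A. A \<in> sets N}" "b \<in> {X -` A \<inter> S |A. A \<in> sets N}"
  then obtain A B where "A \<in> sets N" "B \<in> sets N" "a = X -` A \<inter> S" "b = X -` B \<inter> S" by auto
  then show "a \<inter> b \<in> {X -` A \<inter> S |A. A \<in> sets N}"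
    by (intro CollectI exI[of _ "A \<inter> B"]) auto
qed

lemma Int_stable_source_events: "Int_stable (source_events M X0 \<beta> \<xi> s)"
  by (cases s) (simp_all add: Int_stable_preimages)

lemma preimages_comp_subset:
  assumes Z: "Z \<in> \<Omega> \<rightarrow> space N" and g: "g \<in> N \<rightarrow>\<^sub>M N'"
  shows "{(\<lambda>\<omega>. g (Z \<omega>)) -` A \<inter> \<Omega> |A. A \<in> sets N'} \<subseteq> {Z -` C \<inter> \<Omega> |C. C \<in> sets N}"
proof safe
  fix A assume A: "A \<in> sets N'"
  show "\<exists>C. (\<lambda>\<omega>. g (Z \<omega>)) -` A \<inter> \<Omega> = Z -` C \<inter> \<Omega> \<and> C \<in> sets N"
    using Z measurable_sets[OF g A] by (intro exI[of _ "g -` A \<inter> space N"]) auto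
qed

text \<open>All events determined by coordinates of \<open>Z\<close> are preimages of sets under \<open>Z\<close> itself, because these
  preimages already form a \<open>\<sigma>\<close>-algebra.\<close>

lemma sigma_sets_coordinates_subset:
  assumes Z: "Z \<in> \<Omega> \<rightarrow> space N" and g: "\<And>i. i \<in> I \<Longrightarrow> g i \<in> N \<rightarrow>\<^sub>M N' i"
  shows "sigma_sets \<Omega> (\<Union>i\<in>I. {(\<lambda>\<omega>. g i (Z \<omega>)) -` A \<inter> \<Omega> |A. A \<in> sets (N' i)}) \<subseteq>
    {Z -` C \<inter> \<Omega> |C. C \<in> sets N}"
proof -
  have eq: "{Z -` C \<inter> \<Omega> |C. C \<in> sets N} = sets (vimage_algebra \<Omega> Z N)"
    using Z by (simp add: sets_vimage_algebra2)
  have "sigma_sets (space (vimage_algebra \<Omega> Z N))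
      (\<Union>i\<in>I. {(\<lambda>\<omega>. g i (Z \<omega>)) -` A \<inter> \<Omega> |A. A \<in> sets (N' i)}) \<subseteq> sets (vimage_algebra \<Omega> Z N)"
    by (rule sets.sigma_sets_subset) (use preimages_comp_subset[OF Z g] in \<open>unfold eq, blast\<close>)
  then show ?thesis by (simp add: eq)
qed

text \<open>Two joins give the single family: within each sequence independence is assumed, the two
  sequences are independent as random paths, and the initial state is independent of the pair of paths.\<close>

lemma (in prob_space) indep_sets_source_events:
  assumes driving: "driving_sequences M X0 \<beta> \<xi>"
  shows "indep_sets (source_events M X0 \<beta> \<xi>) UNIV"
proof -
  let ?E = "source_events M X0 \<beta> \<xi>"
  let ?S = "\<lambda>I. sigma_sets (space M) (\<Union>i\<in>I. ?E i)"
  let ?P = "\<Pi>\<^sub>M n\<in>(UNIV :: nat set). (borel :: real measure)"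
  let ?J = "{(\<lambda>\<omega>. (\<lambda>n. \<beta> n \<omega>, \<lambda>n. \<xi> n \<omega>)) -` C \<inter> space M |C. C \<in> sets (?P \<Otimes>\<^sub>M ?P)}"
  note driving = driving[unfolded driving_sequences_def]
  have reindex: "indep_sets ?E (range f)" if "indep_sets (\<lambda>n. ?E (f n)) UNIV" "inj f" for f :: "nat \<Rightarrow> source"
  proof (rule indep_setsI)
    show "?E i \<subseteq> events" if "i \<in> range f" for i
      using \<open>indep_sets (\<lambda>n. ?E (f n)) UNIV\<close> that by (auto simp: indep_sets_def)
    fix A J assume J: "J \<noteq> {}" "J \<subseteq> range f" "finite J" "\<forall>j\<in>J. A j \<in> ?E j"
    then obtain K where K: "J = f ` K" "finite K" by (meson finite_subset_image)
    then show "prob (\<Inter>j\<in>J. A j) = (\<Prod>j\<in>J. prob (A j))"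
      using indep_setsD[OF that(1), of K "\<lambda>n. A (f n)"] J inj_on_subset[OF \<open>inj f\<close>, of K]
      by (simp add: prod.reindex)
  qed
  have ratio: "indep_sets ?E (range Ratio)" and waiting: "indep_sets ?E (range Waiting)"
    by (intro reindex; use driving in \<open>simp add: indep_vars_def2 inj_def\<close>)+
  have ratio_sub: "?S (range Ratio) \<subseteq> {(\<lambda>\<omega> n. \<beta> n \<omega>) -` C \<inter> space M |C. C \<in> sets ?P}"
    and waiting_sub: "?S (range Waiting) \<subseteq> {(\<lambda>\<omega> n. \<xi> n \<omega>) -` C \<inter> space M |C. C \<in> sets ?P}"
    using sigma_sets_coordinates_subset[of "\<lambda>\<omega> n. \<beta> n \<omega>" "space M" ?P UNIV "\<lambda>n x. x n" "\<lambda>_. borel"]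
      sigma_sets_coordinates_subset[of "\<lambda>\<omega> n. \<xi> n \<omega>" "space M" ?P UNIV "\<lambda>n x. x n" "\<lambda>_. borel"]
    by (simp_all add: image_image space_PiM)
  have "indep_set (?S (range Ratio)) (?S (range Waiting))"
  proof -
    have "indep_var ?P (\<lambda>\<omega> n. \<beta> n \<omega>) ?P (\<lambda>\<omega> n. \<xi> n \<omega>)" using driving by simp
    then have "indep_set {(\<lambda>\<omega> n. \<beta> n \<omega>) -` C \<inter> space M |C. C \<in> sets ?P}
      {(\<lambda>\<omega> n. \<xi> n \<omega>) -` C \<inter> space M |C. C \<in> sets ?P}"
      unfolding indep_var_eq by (elim conjE indep_set_mono) (auto intro: sigma_sets.Basic)
    then show ?thesis
      using ratio_sub waiting_sub by (rule indep_set_mono)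
  qed
  then have sequences: "indep_sets ?E (range Ratio \<union> range Waiting)"
    by (intro indep_sets_Un ratio waiting) auto
  have "indep_set (?E Initial) ?J" using driving by simp
  then have "indep_set (sigma_sets (space M) (?E Initial)) (sigma_sets (space M) ?J)"
    by (intro indep_set_sigma_sets Int_stable_source_events Int_stable_preimages)
  moreover have "?S (range Ratio \<union> range Waiting) \<subseteq> sigma_sets (space M) ?J"
  proof (rule sigma_sets_mono)
    have in_paths: "(\<lambda>\<omega>. (\<lambda>n. \<beta> n \<omega>, \<lambda>n. \<xi> n \<omega>)) \<in> space M \<rightarrow> space (?P \<Otimes>\<^sub>M ?P)"
      by (auto simp: space_pair_measure space_PiM)
    have "?E (Ratio n) \<subseteq> ?J" "?E (Waiting n) \<subseteq> ?J" for n
      using preimages_comp_subset[OF in_paths, of "\<lambda>z. fst z n" borel]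
        preimages_comp_subset[OF in_paths, of "\<lambda>z. snd z n" borel] by simp_all
    then have "(\<Union>i\<in>range Ratio \<union> range Waiting. ?E i) \<subseteq> ?J"
      by (intro UN_least) (elim UnE rangeE; simp only:)
    then show "(\<Union>i\<in>range Ratio \<union> range Waiting. ?E i) \<subseteq> sigma_sets (space M) ?J"
      using sigma_sets_superset_generator by (rule order_trans)
  qed
  ultimately have "indep_set (?S {Initial}) (?S (range Ratio \<union> range Waiting))"
    by (simp add: indep_set_mono)
  moreover have "indep_sets ?E {Initial}"
  proof (rule indep_setsI)
    show "?E i \<subseteq> events" if "i \<in> {Initial}" for i
      using that indep_setD_ev1[OF \<open>indep_set (?E Initial) ?J\<close>] by simp
    show "prob (\<Inter>j\<in>J. A j) = (\<Prod>j\<in>J. prob (A j))" if "J \<noteq> {}" "J \<subseteq> {Initial}" for A J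
      using that by (auto simp: subset_singleton_iff)
  qed
  ultimately have "indep_sets ?E ({Initial} \<union> (range Ratio \<union> range Waiting))"
    by (intro indep_sets_Un sequences) auto
  moreover have "{Initial} \<union> (range Ratio \<union> range Waiting) = UNIV"
  proof (rule UNIV_eq_I[symmetric])
    show "s \<in> {Initial} \<union> (range Ratio \<union> range Waiting)" for s by (cases s) auto
  qed
  ultimately show ?thesis by simp
qed

text \<open>The information from which the state of the chain after \<open>n\<close> steps is computed. Unlike the natural
  filtration of the chain, it is built from members of the independent family.\<close>

definition past :: "'w measure \<Rightarrow> ('w \<Rightarrow> real \<times> real) \<Rightarrow> (nat \<Rightarrow> 'w \<Rightarrow> real) \<Rightarrow> (nat \<Rightarrow> 'w \<Rightarrow> real) \<Rightarrow>
    nat \<Rightarrow> 'w measure" where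
  "past M X0 \<beta> \<xi> n = sigma (space M)
     (\<Union>s\<in>insert Initial (Ratio ` {..<n} \<union> Waiting ` {..<n}). source_events M X0 \<beta> \<xi> s)"

lemma source_events_subset: "source_events M X0 \<beta> \<xi> s \<subseteq> Pow (space M)"
  by (cases s) auto

lemma space_past [simp]: "space (past M X0 \<beta> \<xi> n) = space M"
  by (simp add: past_def space_measure_of_conv)

lemma sets_past:
  "sets (past M X0 \<beta> \<xi> n) = sigma_sets (space M)
     (\<Union>s\<in>insert Initial (Ratio ` {..<n} \<union> Waiting ` {..<n}). source_events M X0 \<beta> \<xi> s)"
  unfolding past_def by (intro sets_measure_of UN_least source_events_subset)

lemma sets_past_mono: "m \<le> n \<Longrightarrow> sets (past M X0 \<beta> \<xi> m) \<subseteq> sets (past M X0 \<beta> \<xi> n)"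
  unfolding sets_past by (intro sigma_sets_mono' UN_mono order_refl) auto

lemma measurable_past:
  shows "X0 \<in> borel_measurable (past M X0 \<beta> \<xi> n)"
    and "k < n \<Longrightarrow> \<beta> k \<in> borel_measurable (past M X0 \<beta> \<xi> n)"
    and "k < n \<Longrightarrow> \<xi> k \<in> borel_measurable (past M X0 \<beta> \<xi> n)"
proof -
  have *: "a \<in> sets (past M X0 \<beta> \<xi> n)"
    if "a \<in> source_events M X0 \<beta> \<xi> s" "s \<in> insert Initial (Ratio ` {..<n} \<union> Waiting ` {..<n})" for a s
    unfolding sets_past using that by (intro sigma_sets.Basic) blast
  show "X0 \<in> borel_measurable (past M X0 \<beta> \<xi> n)"
    by (rule measurableI) (use *[of _ Initial] in auto)
  show "\<beta> k \<in> borel_measurable (past M X0 \<beta> \<xi> n)" if "k < n"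
    by (rule measurableI) (use that *[of _ "Ratio k"] in auto)
  show "\<xi> k \<in> borel_measurable (past M X0 \<beta> \<xi> n)" if "k < n"
    by (rule measurableI) (use that *[of _ "Waiting k"] in auto)
qed

lemma (in prob_space) subalgebra_past:
  assumes "indep_sets (source_events M X0 \<beta> \<xi>) UNIV"
  shows "subalgebra M (past M X0 \<beta> \<xi> n)"
proof -
  have "source_events M X0 \<beta> \<xi> s \<subseteq> events" for s
    using assms by (auto simp: indep_sets_def)
  then have "sets (past M X0 \<beta> \<xi> n) \<subseteq> events"
    unfolding sets_past by (intro sets.sigma_sets_subset UN_least)
  then show ?thesis
    by (simp add: subalgebra_def)
qed

text \<open>The past uses the sources up to index \<open>n - 1\<close> and the pair \<open>(\<beta> n, \<xi> n)\<close> uses two further ones;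
  grouping an independent family along disjoint index sets keeps independence.\<close>

lemma (in prob_space) indep_set_past:
  assumes indep: "indep_sets (source_events M X0 \<beta> \<xi>) UNIV"
  shows "indep_set (sets (past M X0 \<beta> \<xi> n)) {(\<lambda>\<omega>. (\<beta> n \<omega>, \<xi> n \<omega>)) -` A \<inter> space M |A. A \<in> sets borel}"
proof -
  let ?I = "\<lambda>b. if b then insert Initial (Ratio ` {..<n} \<union> Waiting ` {..<n}) else {Ratio n, Waiting n}"
  let ?\<sigma> = "\<lambda>b. sigma_sets (space M) (\<Union>s\<in>?I b. source_events M X0 \<beta> \<xi> s)"
  have "indep_sets ?\<sigma> UNIV"
    by (intro indep_sets_collect_sigma Int_stable_source_events indep_sets_mono_index[OF _ indep])
       (auto simp: disjoint_family_on_def)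
  also have "?\<sigma> = case_bool (?\<sigma> True) (?\<sigma> False)"
    by (rule ext) (simp split: bool.split)
  finally have sources: "indep_set (sets (past M X0 \<beta> \<xi> n)) (?\<sigma> False)"
    by (simp only: indep_set_def sets_past if_True)
  let ?N = "sigma (space M) (\<Union>s\<in>?I False. source_events M X0 \<beta> \<xi> s)"
  have sets_N: "sets ?N = ?\<sigma> False"
    by (intro sets_measure_of UN_least source_events_subset)
  have space_N: "space ?N = space M" by (simp add: space_measure_of_conv)
  have event: "a \<in> sets ?N" if "a \<in> source_events M X0 \<beta> \<xi> s" "s \<in> ?I False" for a s
    unfolding sets_N using that by (intro sigma_sets.Basic) blast
  have "\<beta> n \<in> borel_measurable ?N"
    by (rule measurableI, simp, rule event[of _ "Ratio n"]) (unfold space_N, auto)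
  moreover have "\<xi> n \<in> borel_measurable ?N"
    by (rule measurableI, simp, rule event[of _ "Waiting n"]) (unfold space_N, auto)
  ultimately have "(\<lambda>\<omega>. (\<beta> n \<omega>, \<xi> n \<omega>)) \<in> borel_measurable ?N"
    unfolding borel_prod[symmetric] by (rule measurable_Pair)
  then have "{(\<lambda>\<omega>. (\<beta> n \<omega>, \<xi> n \<omega>)) -` A \<inter> space M |A. A \<in> sets borel} \<subseteq> ?\<sigma> False"
    using measurable_sets[of "\<lambda>\<omega>. (\<beta> n \<omega>, \<xi> n \<omega>)" ?N borel] unfolding sets_N space_N by auto
  then show ?thesis by (rule indep_set_mono[OF sources order_refl])
qed

lemma (in prob_space) indep_var_sources:
  assumes indep: "indep_sets (source_events M X0 \<beta> \<xi>) UNIV"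
    and meas: "\<beta> n \<in> borel_measurable M" "\<xi> n \<in> borel_measurable M"
  shows "indep_var borel (\<beta> n) borel (\<xi> n)"
  unfolding indep_var_eq
proof (intro conjI meas indep_set_sigma_sets Int_stable_preimages indep_setI)
  show "prob (a \<inter> b) = prob a * prob b"
    if "a \<in> {\<beta> n -` A \<inter> space M |A. A \<in> sets borel}" "b \<in> {\<xi> n -` A \<inter> space M |A. A \<in> sets borel}" for a b
    using indep_setsD[OF indep, of "{Ratio n, Waiting n}" "\<lambda>s. if s = Ratio n then a else b"] that
    by (simp add: Int_commute)
qed (use meas in \<open>auto intro: measurable_sets\<close>)

section \<open>The Markov chain of half-bases and heights\<close>

lemma measurable_step [measurable]: "step \<in> borel \<Otimes>\<^sub>M borel \<rightarrow>\<^sub>M borel"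
proof -
  have eq: "step = (\<lambda>z. (fst (snd z) * fst (fst z), fst (fst z) ^ 3 * snd (fst z) /
      (fst (fst z) ^ 3 + 3/2 * snd (snd z) * snd (fst z))))"
    by (auto simp: fun_eq_iff)
  show ?thesis
    unfolding eq borel_prod[symmetric] by measurable
qed

lemma step_in_states:
  "x \<in> states \<Longrightarrow> 0 < r \<Longrightarrow> 0 \<le> t \<Longrightarrow> step (x, (r, t)) \<in> states"
  by (cases x) (auto simp: states_def intro!: divide_pos_pos add_pos_nonneg)

text \<open>These signs keep the chain in \<^const>\<open>states\<close>; the denominator of the recursion stays positive.\<close>

lemma (in prob_space) AE_driving_positive:
  assumes "distributed M lborel r (\<lambda>x. ennreal (beta_density 2 2 x))"
    and "distributed M lborel t (\<lambda>x. ennreal (exponential_density 1 x))"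
  shows "AE \<omega> in M. 0 < r \<omega> \<and> 0 \<le> t \<omega>"
proof -
  have "AE \<omega> in M. 0 < r \<omega>"
    by (subst distributed_AE2[OF assms(1)]) (auto simp: beta_density_2_2 split: split_indicator)
  moreover have "AE \<omega> in M. 0 \<le> t \<omega>"
    by (subst distributed_AE2[OF assms(2)]) (auto simp: exponential_density_def)
  ultimately show ?thesis by eventually_elim simp
qed

text \<open>The chain is the random recursion with function \<^const>\<open>step\<close>; the filtration
  \<^const>\<open>past\<close> of the sources transfers their independence to the past of the chain.\<close>

lemma (in prob_space) markov_chain_driven_recursion:
  assumes B: "\<And>n. B n \<in> borel_measurable M" and H: "\<And>n. H n \<in> borel_measurable M"
    and init: "AE \<omega> in M. (B 0 \<omega>, H 0 \<omega>) \<in> states"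
    and driving: "driving_sequences M (\<lambda>\<omega>. (B 0 \<omega>, H 0 \<omega>)) \<beta> \<xi>"
    and recursion: "\<And>n. AE \<omega> in M. (B (Suc n) \<omega>, H (Suc n) \<omega>) = step ((B n \<omega>, H n \<omega>), (\<beta> n \<omega>, \<xi> n \<omega>))"
  shows "markov_chain_with_kernel M states (density_kernel p_inf) (\<lambda>n \<omega>. (B n \<omega>, H n \<omega>))"
proof (rule markov_chain_random_recursion[where f = step and W = "\<lambda>n \<omega>. (\<beta> n \<omega>, \<xi> n \<omega>)"])
  let ?X0 = "\<lambda>\<omega>. (B 0 \<omega>, H 0 \<omega>)"
  have \<beta>: "distributed M lborel (\<beta> n) (\<lambda>x. ennreal (beta_density 2 2 x))"
    and \<xi>: "distributed M lborel (\<xi> n) (\<lambda>x. ennreal (exponential_density 1 x))" for n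
    using driving by (auto simp: driving_sequences_def)
  have [measurable]: "\<beta> n \<in> borel_measurable M" "\<xi> n \<in> borel_measurable M" for n
    using distributed_measurable[OF \<beta>] distributed_measurable[OF \<xi>] by simp_all
  note indep = indep_sets_source_events[OF driving]
  show "states \<in> sets borel"
    by (auto simp: states_def intro!: borel_open open_Times)
  show X: "(\<lambda>\<omega>. (B n \<omega>, H n \<omega>)) \<in> borel_measurable M" for n using B H by simp
  show "(\<lambda>\<omega>. (\<beta> n \<omega>, \<xi> n \<omega>)) \<in> borel_measurable M" for n by simp
  show "indep_set (sets (natural_filtration M (\<lambda>n \<omega>. (B n \<omega>, H n \<omega>)) n))
      {(\<lambda>\<omega>. (\<beta> n \<omega>, \<xi> n \<omega>)) -` A \<inter> space M |A. A \<in> sets borel}" for n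
  proof (rule indep_set_natural_filtration_recursion[where f = step and G = "past M ?X0 \<beta> \<xi>"
        and W = "\<lambda>n \<omega>. (\<beta> n \<omega>, \<xi> n \<omega>)"])
    show "(\<lambda>\<omega>. (\<beta> k \<omega>, \<xi> k \<omega>)) \<in> borel_measurable (past M ?X0 \<beta> \<xi> (Suc k))" for k
      unfolding borel_prod[symmetric] by (intro measurable_Pair measurable_past lessI)
  qed (rule measurable_step X recursion subalgebra_past[OF indep] sets_past_mono measurable_past(1)
      indep_set_past[OF indep] | assumption)+
  show "AE \<omega> in M. \<forall>x\<in>states. step (x, (\<beta> n \<omega>, \<xi> n \<omega>)) \<in> states" for n
    using AE_driving_positive[OF \<beta>[of n] \<xi>[of n]]
    by eventually_elim (intro ballI step_in_states; simp)
  show "distr M borel (\<lambda>\<omega>. step (x, (\<beta> n \<omega>, \<xi> n \<omega>))) = density_kernel p_inf x" if "x \<in> states" for n x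
  proof -
    obtain b h where x: "x = (b, h)" by (cases x)
    then have pos: "0 < b" "0 < h" using that by (auto simp: states_def)
    have "indep_var borel (\<beta> n) borel (\<xi> n)" by (rule indep_var_sources[OF indep]) measurable
    from distr_step_eq_density_kernel[OF \<beta> \<xi> this pos] show ?thesis unfolding x .
  qed
  show "step \<in> borel \<Otimes>\<^sub>M borel \<rightarrow>\<^sub>M borel" by (rule measurable_step)
  show "AE \<omega> in M. (B 0 \<omega>, H 0 \<omega>) \<in> states" by (rule init)
  show "AE \<omega> in M. (B (Suc n) \<omega>, H (Suc n) \<omega>) = step ((B n \<omega>, H n \<omega>), \<beta> n \<omega>, \<xi> n \<omega>)" for n
    by (rule recursion)
qed

theorem proposition3p1:
  fixes M :: "'w measure"
  shows
    "(\<forall>b>0. \<forall>h>0. \<forall>b'>0. \<forall>h'>0. (h' \<noteq> h \<or> b \<le> b') \<longrightarrow>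
        ((\<lambda>lam. p_lam lam (b, h) (b', h')) \<longlongrightarrow> p_inf (b, h) (b', h')) at_top) \<and>
     (\<forall>(B :: nat \<Rightarrow> 'w \<Rightarrow> real) (H :: nat \<Rightarrow> 'w \<Rightarrow> real)
       (\<beta> :: nat \<Rightarrow> 'w \<Rightarrow> real) (\<xi> :: nat \<Rightarrow> 'w \<Rightarrow> real).
        prob_space M \<longrightarrow>
        (\<forall>n. B n \<in> borel_measurable M) \<longrightarrow>
        (\<forall>n. H n \<in> borel_measurable M) \<longrightarrow>
        (AE \<omega> in M. (B 0 \<omega>, H 0 \<omega>) \<in> states) \<longrightarrow>
        driving_sequences M (\<lambda>\<omega>. (B 0 \<omega>, H 0 \<omega>)) \<beta> \<xi> \<longrightarrow>
        (\<forall>n. AE \<omega> in M. (B (Suc n) \<omega>, H (Suc n) \<omega>) =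
           (\<beta> n \<omega> * B n \<omega>,
            (B n \<omega>) ^ 3 * H n \<omega> / ((B n \<omega>) ^ 3 + 3/2 * \<xi> n \<omega> * H n \<omega>))) \<longrightarrow>
        markov_chain_with_kernel M states (density_kernel p_inf) (\<lambda>n \<omega>. (B n \<omega>, H n \<omega>)))"
proof (intro conjI allI impI)
  show "((\<lambda>lam. p_lam lam (b, h) (b', h')) \<longlongrightarrow> p_inf (b, h) (b', h')) at_top"
    if "0 < b" "0 < h" "0 < b'" "0 < h'" "h' \<noteq> h \<or> b \<le> b'" for b h b' h' :: real
    using that by (rule p_lam_tendsto_p_inf)
next
  fix B H \<beta> \<xi> :: "nat \<Rightarrow> 'w \<Rightarrow> real"
  assume "prob_space M"
  then interpret prob_space M .
  assume B: "\<forall>n. B n \<in> borel_measurable M" and H: "\<forall>n. H n \<in> borel_measurable M"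
    and init: "AE \<omega> in M. (B 0 \<omega>, H 0 \<omega>) \<in> states"
    and driving: "driving_sequences M (\<lambda>\<omega>. (B 0 \<omega>, H 0 \<omega>)) \<beta> \<xi>"
    and recursion: "\<forall>n. AE \<omega> in M. (B (Suc n) \<omega>, H (Suc n) \<omega>) =
       (\<beta> n \<omega> * B n \<omega>, (B n \<omega>) ^ 3 * H n \<omega> / ((B n \<omega>) ^ 3 + 3/2 * \<xi> n \<omega> * H n \<omega>))"
  show "markov_chain_with_kernel M states (density_kernel p_inf) (\<lambda>n \<omega>. (B n \<omega>, H n \<omega>))"
  proof (rule markov_chain_driven_recursion[where B = B and H = H, OF spec[OF B] spec[OF H] init driving])
    show "AE \<omega> in M. (B (Suc n) \<omega>, H (Suc n) \<omega>) = step ((B n \<omega>, H n \<omega>), (\<beta> n \<omega>, \<xi> n \<omega>))" for n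
      unfolding step.simps by (rule spec[OF recursion])
  qed
qed

end
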